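(* There exist constants $c>0$ and $C>0$ such that for all sufficiently large $n$ there is a random matrix $\mathbf{A}$ taking values in $\{0,1\}^{n\times n}$ which is $k$-uniform for some $k\ge n^{c}$, and such that every possible value $A$ of $\mathbf{A}$ satisfies $C_\oplus(A)\le C n$.
   Context: A random matrix $\mathbf{A}\in\{0,1\}^{n\times n}$ is called $k$-uniform if for every choice of $k$ rows and $k$ columns, the entries of the corresponding $k\times k$ submatrix have joint (marginal) distribution uniform on $\{0,1\}^{k\times k}$. A circuit is a directed acyclic graph whose in-degree-zero vertices are input gates $x_1,\dots,x_n$ and whose other vertices are gates of unbounded fan-in; some gates are designated outputs $y_1,\dots,y_n$; its size is its number of wires. An XOR-circuit computes the boolean matrix $A=(a_{ij})$ if, with each gate computing the sum modulo 2 of its children, each output computes $y_i=\sum_j a_{ij}x_j$ over $\mathrm{GF}(2)$ as a formal linear form. $C_\oplus(A)$ is the minimum size of an XOR-circuit computing $A$. *)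

theory Defs
  imports
    "HOL-Probability.Probability_Mass_Function"
    "HOL-Library.Z2"
    "HOL-Library.Extended_Nat"
    "HOL-Library.Extended_Real"
    "Jordan_Normal_Form.DL_Submatrix"
begin

text \<open>Boolean matrices are matrices over the two-element field \<^typ>\<open>bit\<close>. A random
  matrix is given by its distribution; its possible values are the elements of the
  support \<^const>\<open>set_pmf\<close>.\<close>

text \<open>The conjunct \<open>k \<le> n\<close> excludes the vacuous case in which there are no
  \<open>k \<times> k\<close> submatrices at all.\<close>

definition k_uniform :: "nat \<Rightarrow> nat \<Rightarrow> bit mat pmf \<Rightarrow> bool" where
  "k_uniform n k p \<longleftrightarrow>
     set_pmf p \<subseteq> carrier_mat n n \<and> k \<le> n \<and>
     (\<forall>I J. I \<subseteq> {..<n} \<and> J \<subseteq> {..<n} \<and> card I = k \<and> card J = k \<longrightarrow>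
        map_pmf (\<lambda>A. submatrix A I J) p = pmf_of_set (carrier_mat k k))"

text \<open>A wire \<open>(u, v)\<close> leads from \<open>u\<close> to \<open>v\<close>, so \<open>u\<close> is a child of \<open>v\<close>. The map \<open>outp\<close> need
  not be injective, and an output may be an input gate.\<close>

record circuit =
  gates :: "nat set"
  wires :: "(nat \<times> nat) set"
  inp :: "nat \<Rightarrow> nat"
  outp :: "nat \<Rightarrow> nat"

definition is_circuit :: "nat \<Rightarrow> nat \<Rightarrow> circuit \<Rightarrow> bool" where
  "is_circuit m n G \<longleftrightarrow>
     finite (gates G) \<and> wires G \<subseteq> gates G \<times> gates G \<and> acyclic (wires G) \<and>
     bij_betw (inp G) {..<n} (gates G - Range (wires G)) \<and>
     outp G ` {..<m} \<subseteq> gates G"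

definition children :: "circuit \<Rightarrow> nat \<Rightarrow> nat set" where
  "children G v = {u. (u, v) \<in> wires G}"

definition circuit_size :: "circuit \<Rightarrow> nat" where
  "circuit_size G = card (wires G)"

text \<open>\<open>f v\<close> is the coefficient vector of the linear form computed at gate \<open>v\<close>. As the
  circuit is finite and acyclic, the conditions determine \<open>f\<close> uniquely on all gates.\<close>

definition xor_forms :: "nat \<Rightarrow> circuit \<Rightarrow> (nat \<Rightarrow> bit vec) \<Rightarrow> bool" where
  "xor_forms n G f \<longleftrightarrow>
     (\<forall>j<n. f (inp G j) = unit_vec n j) \<and>
     (\<forall>v \<in> Range (wires G). f v = vec n (\<lambda>j. \<Sum>u \<in> children G v. f u $ j))"

definition xor_computes :: "circuit \<Rightarrow> bit mat \<Rightarrow> bool" where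
  "xor_computes G A \<longleftrightarrow>
     is_circuit (dim_row A) (dim_col A) G \<and>
     (\<exists>f. xor_forms (dim_col A) G f \<and> (\<forall>i<dim_row A. f (outp G i) = row A i))"

definition C_xor :: "bit mat \<Rightarrow> enat" where
  "C_xor A = (INF G \<in> {G. xor_computes G A}. enat (circuit_size G))"

end

theory Submission
  imports Defs
begin

text \<open>
  Take the random matrix \<open>M X M\<^sup>T\<close>, where \<open>X\<close> is a uniform \<open>m \<times> m\<close> matrix with \<open>m\<^sup>2 \<le> n\<close> and \<open>M\<close>
  is a fixed \<open>n \<times> m\<close> matrix with at most 16 ones per row, any \<open>k\<close> of whose rows are linearly
  independent. A \<open>k \<times> k\<close> submatrix is \<open>M\<^sub>I X M\<^sub>J\<^sup>T\<close>, where \<open>M\<^sub>I\<close> and \<open>M\<^sub>J\<close> have right inverses, so it is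
  the image of a uniform matrix under a surjective linear map and hence uniform; the factorization
  gives a circuit with \<open>O(n + m\<^sup>2)\<close> wires. The matrix \<open>M\<close> is the incidence matrix of a random bipartite
  graph: if the rows in \<open>S\<close> sum to zero, then every neighbour of \<open>S\<close> is hit at least twice, so \<open>S\<close>
  has at most \<open>8 |S|\<close> neighbours, and a union bound excludes this for all nonempty \<open>S\<close> of size at
  most \<open>k\<close>. With \<open>q = \<lfloor>n\<^bsup>1/16\<^esup>\<rfloor>\<close> the parameters \<open>m = q\<^sup>8\<close> and \<open>k = q\<close> work.
\<close>

text \<open>As simp rules these rewrite the arithmetic of \<open>bit\<close> (sums to XOR, products
  to AND, signs away). The ring form is kept so that the general lemmas on sums, fields and matrices
  still match.\<close>

declare add_bit_eq_xor [simp del] mult_bit_eq_and [simp del]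
  minus_bit_def [simp del] uminus_bit_def [simp del]

section \<open>Expanding functions by counting\<close>

text \<open>On \<open>U\<close> such an \<open>F\<close> factors through \<open>{..<h}\<close>: a
  list of \<open>h\<close> values in \<open>V\<close> and, for each point of \<open>U\<close>, an
  index into that list. Outside \<open>U\<close> it is arbitrary. The three factors of the bound
  count these three choices.\<close>

lemma card_PiE_small_image:
  fixes V :: "'b set"
  assumes "finite X" "U \<subseteq> X" "finite V" "V \<noteq> {}"
  shows "card {F \<in> X \<rightarrow>\<^sub>E V. card (F ` U) \<le> h} \<le> card V ^ h * h ^ card U * card V ^ card (X - U)"
proof -
  obtain v0 where v0: "v0 \<in> V" using assms by auto
  have fU: "finite U" using assms finite_subset by auto
  define G where "G = (\<lambda>(g, q, r) x. if x \<in> U then g (q x :: nat) else (r x :: 'b))"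
  let ?D = "({..<h} \<rightarrow>\<^sub>E V) \<times> (U \<rightarrow>\<^sub>E {..<h}) \<times> ((X - U) \<rightarrow>\<^sub>E V)"
  have fin: "finite ?D" using assms fU by (intro finite_cartesian_product finite_PiE) auto
  have "{F \<in> X \<rightarrow>\<^sub>E V. card (F ` U) \<le> h} \<subseteq> G ` ?D"
  proof
    fix F assume "F \<in> {F \<in> X \<rightarrow>\<^sub>E V. card (F ` U) \<le> h}"
    then have F: "F \<in> X \<rightarrow>\<^sub>E V" and ch: "card (F ` U) \<le> h" by auto
    have "finite (F ` U)" using fU by auto
    then obtain e where e: "bij_betw e {..<card (F ` U)} (F ` U)"
      using bij_betw_from_nat_into_finite by blast
    \<comment> \<open>The image may have fewer than \<open>h\<close> elements; \<open>v0\<close>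
      pads the list.\<close>
    define g where "g = (\<lambda>i\<in>{..<h}. if i < card (F ` U) then e i else v0)"
    define q where "q = (\<lambda>x\<in>U. inv_into {..<card (F ` U)} e (F x))"
    have eV: "e i \<in> V" if "i < card (F ` U)" for i
    proof -
      have "e i \<in> F ` U" using bij_betwE[OF e] that by simp
      then show ?thesis using PiE_mem[OF F] assms(2) by auto
    qed
    have qc: "q x < card (F ` U)" if "x \<in> U" for x
    proof -
      have "F x \<in> e ` {..<card (F ` U)}" using e that by (auto simp: bij_betw_def)
      from inv_into_into[OF this] show ?thesis using that by (simp add: q_def)
    qed
    have eq: "e (q x) = F x" if "x \<in> U" for x
    proof -
      have "F x \<in> e ` {..<card (F ` U)}" using e that by (auto simp: bij_betw_def)
      from f_inv_into_f[OF this] show ?thesis using that by (simp add: q_def)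
    qed
    have "g \<in> {..<h} \<rightarrow>\<^sub>E V" using eV v0 by (auto simp: g_def)
    moreover have "q \<in> U \<rightarrow>\<^sub>E {..<h}"
      using qc ch by (intro PiE_I) (fastforce, simp add: q_def)
    moreover have "restrict F (X - U) \<in> (X - U) \<rightarrow>\<^sub>E V" using F by auto
    moreover have "F = G (g, q, restrict F (X - U))"
    proof
      fix x
      show "F x = G (g, q, restrict F (X - U)) x"
        using qc[of x] eq[of x] ch F assms(2) by (auto simp: G_def g_def PiE_def extensional_def)
    qed
    ultimately show "F \<in> G ` ?D" by blast
  qed
  then have "card {F \<in> X \<rightarrow>\<^sub>E V. card (F ` U) \<le> h} \<le> card ?D"
    using fin by (rule surj_card_le[rotated])
  also have "\<dots> = card V ^ h * h ^ card U * card V ^ card (X - U)"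
    using assms fU by (simp add: card_cartesian_product card_funcsetE)
  finally show ?thesis .
qed

text \<open>\<open>F (i, t)\<close> is the \<open>t\<close>-th neighbour of the left vertex
  \<open>i\<close>. Union bound over the sets \<open>S\<close>: by \<open>nmk\<close>, the functions
  failing for some \<open>S\<close> of size \<open>s\<close> make up at most a fraction 1/2^s of all
  functions, and these fractions sum to less than 1.\<close>

lemma exists_expanding_function:
  fixes n m k e :: nat
  assumes nmk: "2 * n * (e * k) ^ (2 * e) \<le> m ^ e" and m: "m > 0"
  obtains F where "F \<in> {..<n} \<times> {..<2 * e} \<rightarrow>\<^sub>E {..<m}"
    "\<And>S. S \<subseteq> {..<n} \<Longrightarrow> S \<noteq> {} \<Longrightarrow> card S \<le> k \<Longrightarrow> e * card S < card (F ` (S \<times> {..<2 * e}))"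
proof -
  define X where "X = {..<n} \<times> {..<2 * e}"
  define P where "P = X \<rightarrow>\<^sub>E {..<m}"
  define bad where "bad S = {F \<in> P. card (F ` (S \<times> {..<2 * e})) \<le> e * card S}" for S
  define T where "T s = {S. S \<subseteq> {..<n} \<and> card S = s}" for s
  have finP: "finite P" by (auto simp: P_def X_def intro!: finite_PiE)
  have cardP: "card P = m ^ (2 * e * n)"
    by (simp add: P_def X_def card_funcsetE card_cartesian_product mult.commute)
  have finT: "finite (T s)" for s by (auto simp: T_def)
  have finbad: "finite (bad S)" for S using finP by (auto simp: bad_def)
  have bound: "2 ^ s * card (\<Union>S\<in>T s. bad S) \<le> card P" if "s \<le> k" "s \<le> n" for s
  proof -
    have "card (bad S) \<le> m ^ (e * s) * (e * s) ^ (2 * e * s) * m ^ (2 * e * (n - s))" if "S \<in> T s" for S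
    proof -
      have S: "S \<subseteq> {..<n}" "card S = s" "finite S"
        using that finite_subset[of S "{..<n}"] by (auto simp: T_def)
      have "X - S \<times> {..<2 * e} = ({..<n} - S) \<times> {..<2 * e}" by (auto simp: X_def)
      then have "card (X - S \<times> {..<2 * e}) = 2 * e * (n - s)"
        using S by (simp add: card_cartesian_product card_Diff_subset mult.commute)
      moreover have "card (S \<times> {..<2 * e}) = s * (2 * e)"
        using S by (simp add: card_cartesian_product)
      moreover have "S \<times> {..<2 * e} \<subseteq> X" "finite X" "{..<m} \<noteq> {}"
        using S m by (auto simp: X_def)
      ultimately show ?thesis
        using card_PiE_small_image[of X "S \<times> {..<2 * e}" "{..<m}" "e * s"] S
        unfolding bad_def P_def by (simp add: mult.commute[of s])
    qed
    then have "(\<Sum>S\<in>T s. card (bad S)) \<le>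
        card (T s) * (m ^ (e * s) * (e * s) ^ (2 * e * s) * m ^ (2 * e * (n - s)))"
      using sum_bounded_above[of "T s" "\<lambda>S. card (bad S)"] by simp
    moreover have "card (T s) \<le> n ^ s"
      using n_subsets[of "{..<n}" s] binomial_le_pow[OF \<open>s \<le> n\<close>] by (simp add: T_def)
    moreover have "card (\<Union>S\<in>T s. bad S) \<le> (\<Sum>S\<in>T s. card (bad S))"
      using finT by (rule card_UN_le)
    ultimately have "card (\<Union>S\<in>T s. bad S) \<le>
        n ^ s * (m ^ (e * s) * (e * s) ^ (2 * e * s) * m ^ (2 * e * (n - s)))"
      by (meson le_trans mult_le_mono1)
    \<comment> \<open>With \<open>k\<close> in place of \<open>s\<close> the base no longer depends
      on \<open>s\<close>, so the factors can be collected into the \<open>s\<close>-th power of the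
      left side of \<open>nmk\<close>.\<close>
    also have "\<dots> \<le> n ^ s * (m ^ (e * s) * (e * k) ^ (2 * e * s) * m ^ (2 * e * (n - s)))"
      using \<open>s \<le> k\<close> by (intro mult_le_mono power_mono) auto
    finally have "2 ^ s * card (\<Union>S\<in>T s. bad S) \<le>
        2 ^ s * (n ^ s * (m ^ (e * s) * (e * k) ^ (2 * e * s) * m ^ (2 * e * (n - s))))"
      by simp
    also have "\<dots> = (2 * n * (e * k) ^ (2 * e)) ^ s * m ^ (e * s) * m ^ (2 * e * (n - s))"
    proof -
      have "(2 * n * (e * k) ^ (2 * e)) ^ s = 2 ^ s * n ^ s * (e * k) ^ (2 * e * s)"
        by (simp only: power_mult_distrib[of "2 * n"] power_mult_distrib[of 2 n]
            power_mult[of "e * k" "2 * e" s])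
      then show ?thesis by simp
    qed
    also have "\<dots> \<le> (m ^ e) ^ s * m ^ (e * s) * m ^ (2 * e * (n - s))"
      by (intro mult_le_mono power_mono nmk) auto
    also have "\<dots> = m ^ (e * s + e * s + 2 * e * (n - s))"
      by (simp only: power_mult[of m e s] power_add)
    \<comment> \<open>One \<open>e * s\<close> counts the choices of image values, the other comes
      from \<open>nmk\<close>; together they match the \<open>2 * e\<close> edges at each of the
      \<open>s\<close> vertices.\<close>
    also have "e * s + e * s + 2 * e * (n - s) = 2 * e * n"
      using \<open>s \<le> n\<close> by (simp add: algebra_simps diff_mult_distrib2)
    finally show ?thesis by (simp add: cardP)
  qed
  have bound': "real (card (\<Union>S\<in>T s. bad S)) \<le> card P * (1/2) ^ s" if "s \<le> k" for s
  proof (cases "s \<le> n")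
    case True
    have "real (2 ^ s * card (\<Union>S\<in>T s. bad S)) \<le> real (card P)"
      using bound[OF that True] of_nat_le_iff by blast
    then show ?thesis by (simp add: field_simps)
  next
    case False
    then have "T s = {}" using card_mono[of "{..<n}"] by (fastforce simp: T_def)
    then show ?thesis by simp
  qed
  have "real (card (\<Union>s\<in>{1..k}. \<Union>S\<in>T s. bad S)) \<le> (\<Sum>s\<in>{1..k}. real (card (\<Union>S\<in>T s. bad S)))"
    using card_UN_le[of "{1..k}" "\<lambda>s. \<Union>S\<in>T s. bad S"] by (simp flip: of_nat_sum)
  also have "\<dots> \<le> (\<Sum>s\<in>{1..k}. card P * (1/2) ^ s)"
    using bound' by (intro sum_mono) auto
  \<comment> \<open>The sum starts at \<open>s = 1\<close>, so it stays strictly below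
    \<open>card P\<close>, which is what leaves a good function.\<close>
  also have "\<dots> = card P * (1 - (1/2) ^ k)"
    by (simp add: sum_distrib_left[symmetric] sum_gp)
  also have "\<dots> < card P" using m by (simp add: cardP)
  finally have "\<not> P \<subseteq> (\<Union>s\<in>{1..k}. \<Union>S\<in>T s. bad S)"
    using card_mono[of "\<Union>s\<in>{1..k}. \<Union>S\<in>T s. bad S" P] finbad finT by fastforce
  then obtain F where F: "F \<in> P" "F \<notin> (\<Union>s\<in>{1..k}. \<Union>S\<in>T s. bad S)" by blast
  show thesis
  proof
    show "F \<in> {..<n} \<times> {..<2 * e} \<rightarrow>\<^sub>E {..<m}" using F by (simp add: P_def X_def)
    fix S assume S: "S \<subseteq> {..<n}" "S \<noteq> {}" "card S \<le> k"
    then have "card S \<in> {1..k}"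
      by (metis One_nat_def atLeastAtMost_iff card_gt_0_iff finite_lessThan finite_subset Suc_leI)
    then have "F \<notin> bad S" using F(2) S by (auto simp: T_def)
    then show "e * card S < card (F ` (S \<times> {..<2 * e}))" using F(1) by (auto simp: bad_def)
  qed
qed

section \<open>Right inverses of independent rows\<close>

text \<open>\<open>W\<close> is a right inverse of the matrix with rows \<open>M i\<close>. It is
  built one row at a time, in the manner of Gram-Schmidt: a dual vector for the new row is found
  first, then the old dual vectors are corrected by multiples of it.\<close>

lemma dual_family_exists:
  fixes M :: "'i \<Rightarrow> 'a \<Rightarrow> 'b :: field"
  assumes "finite I" "finite A"
    and "\<And>c. (\<And>a. a \<in> A \<Longrightarrow> (\<Sum>i\<in>I. c i * M i a) = 0) \<Longrightarrow> \<forall>i\<in>I. c i = 0"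
  shows "\<exists>W. \<forall>i\<in>I. \<forall>j\<in>I. (\<Sum>a\<in>A. M i a * W a j) = of_bool (i = j)"
  using assms(1,3)
proof (induction I rule: finite_induct)
  case empty
  then show ?case by simp
next
  case (insert x I)
  have "\<forall>i\<in>I. c i = 0" if c: "\<And>a. a \<in> A \<Longrightarrow> (\<Sum>i\<in>I. c i * M i a) = 0" for c
  proof -
    have "(\<Sum>i\<in>I. (c(x := 0)) i * M i a) = (\<Sum>i\<in>I. c i * M i a)" for a
      using insert.hyps by (intro sum.cong) auto
    then have "\<forall>i\<in>insert x I. (c(x := 0)) i = 0"
      using insert.hyps c by (intro insert.prems) (simp del: fun_upd_apply, simp)
    then show ?thesis using insert.hyps by (auto split: if_splits)
  qed
  from insert.IH[OF this] obtain W
    where W: "\<And>i j. i \<in> I \<Longrightarrow> j \<in> I \<Longrightarrow> (\<Sum>a\<in>A. M i a * W a j) = of_bool (i = j)" by blast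
  \<comment> \<open>\<open>v\<close> is the new row minus the combination of old rows that has the
    same pairings \<open>d\<close> with the old dual vectors. If it vanished on \<open>A\<close>,
    the rows would satisfy a relation with coefficient 1 at \<open>x\<close>.\<close>
  define d where "d i = (\<Sum>a\<in>A. M x a * W a i)" for i
  define v where "v b = M x b - (\<Sum>i\<in>I. d i * M i b)" for b
  have "\<exists>b\<in>A. v b \<noteq> 0"
  proof (rule ccontr)
    assume "\<not> ?thesis"
    then have v: "v b = 0" if "b \<in> A" for b using that by auto
    have "\<forall>i\<in>insert x I. (\<lambda>i. if i = x then 1 else - d i) i = 0"
    proof (rule insert.prems)
      fix a assume "a \<in> A"
      have "(\<Sum>i\<in>I. (if i = x then 1 else - d i) * M i a) = (\<Sum>i\<in>I. - d i * M i a)"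
        using insert.hyps by (intro sum.cong) auto
      then show "(\<Sum>i\<in>insert x I. (if i = x then 1 else - d i) * M i a) = 0"
        using insert.hyps v[OF \<open>a \<in> A\<close>] by (simp add: v_def sum_negf)
    qed
    then show False by simp
  qed
  then obtain b where b: "b \<in> A" "v b \<noteq> 0" by blast
  \<comment> \<open>The unit vector at \<open>b\<close>, corrected so that every old row annihilates
    it. Its pairing with the new row is then \<open>v b\<close>, hence the division.\<close>
  define w where "w a = (of_bool (a = b) - (\<Sum>i\<in>I. W a i * M i b)) / v b" for a
  have Mw: "(\<Sum>a\<in>A. M j a * w a) = (M j b - (\<Sum>i\<in>I. (\<Sum>a\<in>A. M j a * W a i) * M i b)) / v b" for j
  proof -
    have "(\<Sum>a\<in>A. M j a * w a) = (\<Sum>a\<in>A. M j a * of_bool (a = b) - (\<Sum>i\<in>I. M j a * W a i * M i b)) / v b"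
      unfolding w_def sum_divide_distrib
      by (intro sum.cong) (auto simp: algebra_simps sum_distrib_left)
    also have "(\<Sum>a\<in>A. M j a * of_bool (a = b)) = M j b"
      using b(1) assms(2) by (simp add: of_bool_def if_distrib[of "\<lambda>z. _ * z"] sum.delta cong: if_cong)
    then have "(\<Sum>a\<in>A. M j a * of_bool (a = b) - (\<Sum>i\<in>I. M j a * W a i * M i b))
        = M j b - (\<Sum>i\<in>I. (\<Sum>a\<in>A. M j a * W a i) * M i b)"
      by (simp add: sum_subtractf sum_distrib_right sum.swap[of _ I A])
    finally show ?thesis .
  qed
  have w1: "(\<Sum>a\<in>A. M x a * w a) = 1"
    using b by (simp add: Mw flip: d_def) (simp add: v_def)
  have w0: "(\<Sum>a\<in>A. M j a * w a) = 0" if "j \<in> I" for j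
    using that insert.hyps W[OF that]
    by (simp add: Mw of_bool_def if_distrib[of "\<lambda>z. z * _"] sum.delta cong: if_cong)
  \<comment> \<open>Subtracting \<open>d i * w\<close> makes the new row annihilate the old dual
    vectors; the old rows do not notice, as they annihilate \<open>w\<close>.\<close>
  define W' where "W' a i = (if i = x then w a else W a i - d i * w a)" for a i
  have "(\<Sum>a\<in>A. M i a * W' a j) = of_bool (i = j)" if "i \<in> insert x I" "j \<in> insert x I" for i j
  proof (cases "j = x")
    case True
    then show ?thesis using that w1 w0 insert.hyps by (auto simp: W'_def)
  next
    case False
    then have "(\<Sum>a\<in>A. M i a * W' a j) = (\<Sum>a\<in>A. M i a * W a j) - d j * (\<Sum>a\<in>A. M i a * w a)"
      by (simp add: W'_def algebra_simps sum_subtractf sum_distrib_left)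
    then show ?thesis
      using that False w1 w0 insert.hyps W by (auto simp flip: d_def)
  qed
  then show ?case by blast
qed

section \<open>Images of uniform matrices under linear maps\<close>

text \<open>Fibres of equal size \<open>c\<close> give \<open>card A = c * card B\<close>, so each
  point of \<open>B\<close> receives mass \<open>c / card A = 1 / card B\<close>.\<close>

lemma map_pmf_of_set_regular:
  assumes "finite A" "A \<noteq> {}" "f ` A = B" and fib: "\<And>y. y \<in> B \<Longrightarrow> card {x \<in> A. f x = y} = c"
  shows "map_pmf f (pmf_of_set A) = pmf_of_set B"
proof (rule pmf_eqI)
  fix y
  have fB: "finite B" "B \<noteq> {}" using assms by auto
  have "card A = (\<Sum>y\<in>B. card {x \<in> A. f x = y})"
    using sum.image_gen[OF assms(1), of "\<lambda>_. 1 :: nat" f] assms(3) by simp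
  then have cA: "card A = c * card B" using fib by simp
  have "card A > 0" using assms by (simp add: card_gt_0_iff)
  then have c0: "c > 0" using cA by (cases c) auto
  have "pmf (map_pmf f (pmf_of_set A)) y = card {x \<in> A. f x = y} / card A"
    using assms by (simp add: pmf_map measure_pmf_of_set vimage_def Int_def)
  also have "\<dots> = indicator B y / card B"
  proof (cases "y \<in> B")
    case True
    then show ?thesis using c0 cA fib by simp
  next
    case False
    then have "{x \<in> A. f x = y} = {}" using assms by auto
    then show ?thesis using False by (simp del: Collect_empty_eq)
  qed
  also have "\<dots> = pmf (pmf_of_set B) y" using fB by simp
  finally show "pmf (map_pmf f (pmf_of_set A)) y = pmf (pmf_of_set B) y" .
qed

lemma finite_carrier_mat:
  assumes "finite (UNIV :: 'a set)"
  shows "finite (carrier_mat r s :: 'a mat set)"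
proof -
  have "carrier_mat r s \<subseteq> (\<lambda>f. mat r s f) ` (({..<r} \<times> {..<s}) \<rightarrow>\<^sub>E (UNIV :: 'a set))"
  proof
    fix A :: "'a mat" assume "A \<in> carrier_mat r s"
    then have "A = mat r s (restrict (\<lambda>ij. A $$ ij) ({..<r} \<times> {..<s}))"
      by (intro eq_matI) auto
    then show "A \<in> (\<lambda>f. mat r s f) ` (({..<r} \<times> {..<s}) \<rightarrow>\<^sub>E UNIV)"
      by (intro image_eqI[where x = "restrict (\<lambda>ij. A $$ ij) ({..<r} \<times> {..<s})"]) auto
  qed
  then show ?thesis by (rule finite_subset) (intro finite_imageI finite_PiE assms, auto simp: assms)
qed

lemma finite_UNIV_bit: "finite (UNIV :: bit set)"
proof -
  have "(UNIV :: bit set) = {0, 1}" using bit_not_zero_iff by blast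
  then show ?thesis by (metis finite.simps)
qed

text \<open>The one-sided inverses make the linear map surjective, with \<open>L' * Y * R'\<close>
  as a preimage of \<open>Y\<close>. Its fibres are translates of its kernel and so all have the
  same size.\<close>

lemma map_pmf_mult_mat_uniform:
  fixes L :: "'a :: field mat"
  assumes fin: "finite (UNIV :: 'a set)"
    and L: "L \<in> carrier_mat k m" "L' \<in> carrier_mat m k" "L * L' = 1\<^sub>m k"
    and R: "R \<in> carrier_mat m' k'" "R' \<in> carrier_mat k' m'" "R' * R = 1\<^sub>m k'"
  shows "map_pmf (\<lambda>X. L * X * R) (pmf_of_set (carrier_mat m m')) = pmf_of_set (carrier_mat k k')"
proof (rule map_pmf_of_set_regular)
  let ?f = "\<lambda>X. L * X * R"
  have lift: "?f (L' * Y * R') = Y" if Y: "Y \<in> carrier_mat k k'" for Y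
  proof -
    have "L * (L' * Y * R') = (L * L') * (Y * R')"
      using assoc_mult_mat[OF L(2) Y R(2)] assoc_mult_mat[OF L(1,2), of "Y * R'" m'] Y R by simp
    also have "\<dots> = Y * R'" using L R Y by simp
    finally have "?f (L' * Y * R') = Y * (R' * R)" using assoc_mult_mat[OF Y R(2,1)] by simp
    then show ?thesis using R Y by simp
  qed
  show "?f ` carrier_mat m m' = carrier_mat k k'"
  proof
    show "?f ` carrier_mat m m' \<subseteq> carrier_mat k k'" using L R by auto
    show "carrier_mat k k' \<subseteq> ?f ` carrier_mat m m'"
    proof
      fix Y :: "'a mat" assume Y: "Y \<in> carrier_mat k k'"
      then have "L' * Y * R' \<in> carrier_mat m m'" using L R by auto
      then show "Y \<in> ?f ` carrier_mat m m'" using lift[OF Y] by (metis imageI)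
    qed
  qed
  fix Y :: "'a mat" assume Y: "Y \<in> carrier_mat k k'"
  define X0 where "X0 = L' * Y * R'"
  have X0: "X0 \<in> carrier_mat m m'" "?f X0 = Y" using lift[OF Y] L R Y by (auto simp: X0_def)
  have add: "?f (X + Z) = ?f X + ?f Z" if "X \<in> carrier_mat m m'" "Z \<in> carrier_mat m m'" for X Z
    using that L R by (simp add: mult_add_distrib_mat[of _ k m] add_mult_distrib_mat[of _ k m'])
  have sub: "?f (X - Z) = ?f X - ?f Z" if "X \<in> carrier_mat m m'" "Z \<in> carrier_mat m m'" for X Z
    using that L R by (simp add: mult_minus_distrib_mat[of _ k m] minus_mult_distrib_mat[of _ k m'])
  \<comment> \<open>Translation by the preimage \<open>X0\<close> carries the kernel onto the fibre
    over \<open>Y\<close>.\<close>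
  have "bij_betw (\<lambda>X. X + X0) {X \<in> carrier_mat m m'. ?f X = 0\<^sub>m k k'} {X \<in> carrier_mat m m'. ?f X = Y}"
  proof (rule bij_betw_byWitness[where f' = "\<lambda>X. X - X0"])
    show "\<forall>X\<in>{X \<in> carrier_mat m m'. ?f X = 0\<^sub>m k k'}. X + X0 - X0 = X" using X0 by auto
    show "\<forall>X\<in>{X \<in> carrier_mat m m'. ?f X = Y}. X - X0 + X0 = X" using X0 by auto
    show "(\<lambda>X. X + X0) ` {X \<in> carrier_mat m m'. ?f X = 0\<^sub>m k k'} \<subseteq> {X \<in> carrier_mat m m'. ?f X = Y}"
      using X0 add Y by auto
    show "(\<lambda>X. X - X0) ` {X \<in> carrier_mat m m'. ?f X = Y} \<subseteq> {X \<in> carrier_mat m m'. ?f X = 0\<^sub>m k k'}"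
      using X0 sub Y by auto
  qed
  then show "card {X \<in> carrier_mat m m'. ?f X = Y} = card {X \<in> carrier_mat m m'. ?f X = 0\<^sub>m k k'}"
    by (rule bij_betw_same_card[symmetric])
next
  show "finite (carrier_mat m m' :: 'a mat set)" using fin by (rule finite_carrier_mat)
  show "carrier_mat m m' \<noteq> ({} :: 'a mat set)" using zero_carrier_mat by blast
qed

section \<open>Layered circuits for matrix products\<close>

text \<open>A normal form for circuits: gates are numbered topologically with the inputs first, so
  acyclicity follows from the order on numbers. The assumption \<open>ran\<close> says that exactly
  the inputs have in-degree zero.\<close>

lemma C_xor_le_card_wires:
  assumes A: "A \<in> carrier_mat r n" and "n \<le> N"
    and lt: "\<And>u v. (u, v) \<in> W \<Longrightarrow> u < v \<and> v < N"
    and ran: "Range W = {n..<N}"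
    and out: "\<And>i. i < r \<Longrightarrow> out i < N \<and> f (out i) = row A i"
    and inp: "\<And>j. j < n \<Longrightarrow> f j = unit_vec n j"
    and gate: "\<And>v. n \<le> v \<Longrightarrow> v < N \<Longrightarrow> f v = vec n (\<lambda>j. \<Sum>u\<in>{u. (u, v) \<in> W}. f u $ j)"
  shows "C_xor A \<le> enat (card W)"
proof -
  define G where "G = \<lparr>gates = {..<N}, wires = W, inp = id, outp = out\<rparr>"
  have "W \<subseteq> less_than" using lt by auto
  then have "acyclic W" by (rule acyclic_subset[OF wf_acyclic[OF wf_less_than]])
  moreover have "{..<N} - {n..<N} = {..<n}" using \<open>n \<le> N\<close> by auto
  moreover have "W \<subseteq> {..<N} \<times> {..<N}" using lt by fastforce
  ultimately have "is_circuit r n G"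
    using out by (auto simp: is_circuit_def G_def ran)
  moreover have "xor_forms n G f"
    using inp gate by (auto simp: xor_forms_def G_def ran children_def)
  ultimately have "xor_computes G A"
    using A out by (auto simp: xor_computes_def G_def)
  then have "C_xor A \<le> enat (circuit_size G)"
    unfolding C_xor_def by (intro INF_lower) simp
  then show ?thesis by (simp add: circuit_size_def G_def)
qed


text \<open>Kept as a set of index pairs because each nonzero entry of a factor becomes one
  wire.\<close>

definition support_mat :: "'a :: zero mat \<Rightarrow> (nat \<times> nat) set" where
  "support_mat A = {(i, j). i < dim_row A \<and> j < dim_col A \<and> A $$ (i, j) \<noteq> 0}"

lemma support_mat_subset: "support_mat A \<subseteq> {..<dim_row A} \<times> {..<dim_col A}"
  by (auto simp: support_mat_def)

lemma finite_support_mat [simp]: "finite (support_mat A)"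
  by (rule finite_subset[OF support_mat_subset]) simp

lemma card_support_mat_le: "card (support_mat A) \<le> dim_row A * dim_col A"
  using card_mono[OF _ support_mat_subset[of A]] by (simp add: card_cartesian_product)

lemma card_support_mat_transpose [simp]: "card (support_mat A\<^sup>T) = card (support_mat A)"
proof -
  have "support_mat A\<^sup>T = prod.swap ` support_mat A"
    by (force simp: support_mat_def)
  then show ?thesis by (simp add: card_image)
qed

text \<open>Correctness of one layer: if consecutive gates from \<open>d\<close> on compute the rows
  of \<open>D\<close>, a gate wired according to row \<open>a\<close> of \<open>B\<close> computes
  row \<open>a\<close> of \<open>B * D\<close>, since a nonzero coefficient in \<open>bit\<close> is
  1. The extra child \<open>z\<close> computes the zero form and changes nothing.\<close>

lemma row_mult_mat_eq_sum:
  fixes B D :: "bit mat"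
  assumes "B \<in> carrier_mat s t" "D \<in> carrier_mat t n" "a < s"
    and "f z = 0\<^sub>v n" "z \<notin> {d..<d + t}" "\<And>b. b < t \<Longrightarrow> f (d + b) = row D b"
    and K: "K = insert z ((\<lambda>b. d + b) ` {b. b < t \<and> B $$ (a, b) \<noteq> 0})"
  shows "row (B * D) a = vec n (\<lambda>j. \<Sum>u\<in>K. vec_index (f u) j)"
proof (rule eq_vecI)
  fix j assume "j < dim_vec (vec n (\<lambda>j. \<Sum>u\<in>K. vec_index (f u) j))"
  then have j: "j < n" by simp
  have "(\<Sum>u\<in>K. vec_index (f u) j) = (\<Sum>u\<in>(\<lambda>b. d + b) ` {b. b < t \<and> B $$ (a, b) \<noteq> 0}. vec_index (f u) j)"
    unfolding K using assms j by (subst sum.insert) auto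
  also have "\<dots> = (\<Sum>b\<in>{b. b < t \<and> B $$ (a, b) \<noteq> 0}. D $$ (b, j))"
    using assms j by (subst sum.reindex) (auto intro!: inj_onI sum.cong)
  also have "\<dots> = (\<Sum>b\<in>{0..<t}. B $$ (a, b) * D $$ (b, j))"
    by (rule sum.mono_neutral_cong_left) auto
  also have "\<dots> = vec_index (row (B * D) a) j"
    using assms j by (simp add: scalar_prod_def)
  finally show "vec_index (row (B * D) a) j = vec_index (vec n (\<lambda>j. \<Sum>u\<in>K. vec_index (f u) j)) j"
    using j by simp
qed (use assms in auto)

text \<open>The product is evaluated from the right in three layers, for the rows of
  \<open>R\<close>, of \<open>X * R\<close> and of \<open>L * (X * R)\<close>. Nonzero entries of
  the factors give the three support terms.\<close>

lemma C_xor_mult3_le: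
  assumes L: "L \<in> carrier_mat r p" and X: "X \<in> carrier_mat p q" and R: "R \<in> carrier_mat q n"
    and n: "n > 0"
  shows "C_xor (L * X * R) \<le>
    enat (card (support_mat L) + card (support_mat X) + card (support_mat R) + (p + q + r + 3))"
proof -
  txt \<open>A gate without wires would count as an input, yet rows of the factors may vanish. Gate \<open>n\<close>
    copies input 0, so gate \<open>n + 1\<close> computes the sum of two equal forms, that is zero, and is wired
    to every later gate.\<close>
  define N where "N = n + 2 + q + p + r"
  define W0 where "W0 = {(0, n), (0, n + 1), (n, n + 1)}"
  define WZ where "WZ = (\<lambda>v. (n + 1, v)) ` {n + 2..<N}"
  define WR where "WR = (\<lambda>(b, j). (j, n + 2 + b)) ` support_mat R"
  define WX where "WX = (\<lambda>(a, b). (n + 2 + b, n + 2 + q + a)) ` support_mat X"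
  define WL where "WL = (\<lambda>(i, a). (n + 2 + q + a, n + 2 + q + p + i)) ` support_mat L"
  define W where "W = W0 \<union> WZ \<union> WR \<union> WX \<union> WL"
  define f where "f v = (if v < n then unit_vec n v else if v = n then unit_vec n 0
    else if v = n + 1 then 0\<^sub>v n else if v < n + 2 + q then row R (v - (n + 2))
    else if v < n + 2 + q + p then row (X * R) (v - (n + 2 + q))
    else row (L * (X * R)) (v - (n + 2 + q + p)))" for v
  have dims: "dim_row L = r" "dim_col L = p" "dim_row X = p" "dim_col X = q" "dim_row R = q" "dim_col R = n"
    using L X R by auto
  \<comment> \<open>Apart from the wires out of gate \<open>n + 1\<close>, the parts of
    \<open>W\<close> end at disjoint ranges of gates, so the children of a gate can be read off from
    its number.\<close>
  have W_iff: "(u, v) \<in> W \<longleftrightarrow> (u = 0 \<and> v = n) \<or> (u = 0 \<and> v = n + 1) \<or> (u = n \<and> v = n + 1)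
      \<or> (u = n + 1 \<and> n + 2 \<le> v \<and> v < N)
      \<or> (\<exists>b<q. v = n + 2 + b \<and> u < n \<and> R $$ (b, u) \<noteq> 0)
      \<or> (\<exists>a<p. v = n + 2 + q + a \<and> (\<exists>b<q. u = n + 2 + b \<and> X $$ (a, b) \<noteq> 0))
      \<or> (\<exists>i<r. v = n + 2 + q + p + i \<and> (\<exists>a<p. u = n + 2 + q + a \<and> L $$ (i, a) \<noteq> 0))" for u v
  proof -
    have "(u, v) \<in> WR \<longleftrightarrow> (\<exists>b<q. v = n + 2 + b \<and> u < n \<and> R $$ (b, u) \<noteq> 0)"
      by (auto simp: WR_def support_mat_def dims image_iff simp del: bit_not_zero_iff)
    moreover have "(u, v) \<in> WX \<longleftrightarrow>
        (\<exists>a<p. v = n + 2 + q + a \<and> (\<exists>b<q. u = n + 2 + b \<and> X $$ (a, b) \<noteq> 0))"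
      by (auto simp: WX_def support_mat_def dims image_iff simp del: bit_not_zero_iff)
    moreover have "(u, v) \<in> WL \<longleftrightarrow>
        (\<exists>i<r. v = n + 2 + q + p + i \<and> (\<exists>a<p. u = n + 2 + q + a \<and> L $$ (i, a) \<noteq> 0))"
      by (auto simp: WL_def support_mat_def dims image_iff simp del: bit_not_zero_iff)
    moreover have "(u, v) \<in> W0 \<longleftrightarrow> (u = 0 \<and> v = n) \<or> (u = 0 \<and> v = n + 1) \<or> (u = n \<and> v = n + 1)"
      by (auto simp: W0_def)
    moreover have "(u, v) \<in> WZ \<longleftrightarrow> u = n + 1 \<and> n + 2 \<le> v \<and> v < N"
      by (auto simp: WZ_def image_iff)
    ultimately show ?thesis unfolding W_def Un_iff by argo
  qed
  have lt: "u < v \<and> v < N" if "(u, v) \<in> W" for u v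
    using that n unfolding W_iff N_def by auto
  have "v \<in> Range W" if v: "n \<le> v" "v < N" for v
  proof -
    consider "v = n" | "v = n + 1" | "n + 2 \<le> v" using v by linarith
    then show ?thesis
    proof cases
      case 3
      then have "(n + 1, v) \<in> W" using v by (auto simp: W_def WZ_def)
      then show ?thesis by blast
    qed (auto simp: W_def W0_def)
  qed
  moreover have "n \<le> v" if "(u, v) \<in> W" for u v
    using that unfolding W_iff by auto
  ultimately have ran: "Range W = {n..<N}" using lt by fastforce
  have f0: "f (n + 1) = 0\<^sub>v n"
    and f_in: "\<And>j. j < n \<Longrightarrow> f j = unit_vec n j"
    and f_R: "\<And>b. b < q \<Longrightarrow> f (n + 2 + b) = row R b"
    and f_X: "\<And>a. a < p \<Longrightarrow> f (n + 2 + q + a) = row (X * R) a"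
    and f_L: "\<And>i. f (n + 2 + q + p + i) = row (L * (X * R)) i"
    by (simp_all add: f_def)
  have gate: "f v = vec n (\<lambda>j. \<Sum>u\<in>{u. (u, v) \<in> W}. vec_index (f u) j)" if v: "n \<le> v" "v < N" for v
  proof -
    consider "v = n" | "v = n + 1" | b where "b < q" "v = n + 2 + b"
      | a where "a < p" "v = n + 2 + q + a" | i where "i < r" "v = n + 2 + q + p + i"
    proof -
      have "v = n \<or> v = n + 1 \<or> (v - (n + 2) < q \<and> v = n + 2 + (v - (n + 2))) \<or>
        (v - (n + 2 + q) < p \<and> v = n + 2 + q + (v - (n + 2 + q))) \<or>
        (v - (n + 2 + q + p) < r \<and> v = n + 2 + q + p + (v - (n + 2 + q + p)))"
        using v unfolding N_def by linarith
      then show thesis using that by metis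
    qed
    then show ?thesis
    proof cases
      case 1
      have "{u. (u, n) \<in> W} = {0}" unfolding W_iff by auto
      moreover have "f n = unit_vec n 0" "f 0 = unit_vec n 0" using n by (simp_all add: f_def)
      ultimately show ?thesis unfolding 1 by (intro eq_vecI) simp_all
    next
      case 2
      have "{u. (u, n + 1) \<in> W} = {0, n}" unfolding W_iff by auto
      moreover have "f n = unit_vec n 0" "f 0 = unit_vec n 0" using n by (simp_all add: f_def)
      ultimately show ?thesis unfolding 2 f0 using n by (intro eq_vecI) simp_all
    next
      case b: 3
      have K: "{u. (u, v) \<in> W} = insert (n + 1) ((\<lambda>j. 0 + j) ` {j. j < n \<and> R $$ (b, j) \<noteq> 0})"
        using b unfolding W_iff N_def by auto
      \<comment> \<open>The inputs compute the rows of the identity matrix, so the first layer is an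
        instance of the same lemma with offset 0.\<close>
      have "row (R * 1\<^sub>m n) b = vec n (\<lambda>j. \<Sum>u\<in>{u. (u, v) \<in> W}. vec_index (f u) j)"
        by (rule row_mult_mat_eq_sum[where f = f and z = "n + 1", OF R one_carrier_mat b(1) f0 _ _ K]) (simp_all add: f_in)
      then show ?thesis using R f_R[OF b(1)] unfolding b(2) by simp
    next
      case a: 4
      have K: "{u. (u, v) \<in> W} = insert (n + 1) ((\<lambda>b. (n + 2) + b) ` {b. b < q \<and> X $$ (a, b) \<noteq> 0})"
        using a unfolding W_iff N_def by auto
      have "row (X * R) a = vec n (\<lambda>j. \<Sum>u\<in>{u. (u, v) \<in> W}. vec_index (f u) j)"
        by (rule row_mult_mat_eq_sum[where f = f and z = "n + 1", OF X R a(1) f0 _ f_R K]) simp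
      then show ?thesis using f_X[OF a(1)] unfolding a(2) by simp
    next
      case i: 5
      have K: "{u. (u, v) \<in> W} = insert (n + 1) ((\<lambda>a. (n + 2 + q) + a) ` {a. a < p \<and> L $$ (i, a) \<noteq> 0})"
        using i unfolding W_iff N_def by auto
      have XR: "X * R \<in> carrier_mat p n" using X R by simp
      have "row (L * (X * R)) i = vec n (\<lambda>j. \<Sum>u\<in>{u. (u, v) \<in> W}. vec_index (f u) j)"
        by (rule row_mult_mat_eq_sum[where f = f and z = "n + 1", OF L XR i(1) f0 _ f_X K]) simp
      then show ?thesis using f_L[of i] unfolding i(2) by simp
    qed
  qed
  have "C_xor (L * (X * R)) \<le> enat (card W)"
  proof (rule C_xor_le_card_wires[OF _ _ lt ran _ _ gate])
    show "L * (X * R) \<in> carrier_mat r n" using L X R by simp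
    show "n + 2 + q + p + i < N \<and> f (n + 2 + q + p + i) = row (L * (X * R)) i" if "i < r" for i
      using that f_L[of i] by (simp add: N_def)
  qed (simp_all add: N_def f_in)
  also have "card W \<le> card W0 + card WZ + card WR + card WX + card WL"
    unfolding W_def by (meson card_Un_le add_mono order_trans order_refl)
  also have "card W0 \<le> 3" by (simp add: W0_def card_insert_if)
  also have "card WZ = q + p + r" by (simp add: WZ_def N_def card_image inj_on_def)
  also have "card WR \<le> card (support_mat R)" unfolding WR_def by (rule card_image_le) simp
  also have "card WX \<le> card (support_mat X)" unfolding WX_def by (rule card_image_le) simp
  also have "card WL \<le> card (support_mat L)" unfolding WL_def by (rule card_image_le) simp
  finally have "C_xor (L * (X * R)) \<le>
      enat (3 + (q + p + r) + card (support_mat R) + card (support_mat X) + card (support_mat L))"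
    by simp
  then show ?thesis using L X R by (simp add: algebra_simps)
qed

section \<open>From expansion to independent rows and uniform submatrices\<close>

text \<open>If all sums vanished, every value of \<open>F\<close> on
  \<open>S \<times> {..<2 * e}\<close> would be attained an even number of times, hence at least
  twice. There would be at most \<open>e * card S\<close> values, against
  \<open>exp\<close>.\<close>

lemma sum_incidence_nonzero:
  fixes F :: "nat \<times> nat \<Rightarrow> nat"
  assumes "finite S" "F ` (S \<times> {..<2 * e}) \<subseteq> V"
    and exp: "e * card S < card (F ` (S \<times> {..<2 * e}))"
  shows "\<exists>a\<in>V. (\<Sum>i\<in>S. \<Sum>t<2 * e. of_bool (F (i, t) = a) :: bit) \<noteq> 0"
proof (rule ccontr)
  define U where "U = S \<times> {..<2 * e}"
  have finU: "finite U" using assms by (simp add: U_def)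
  assume "\<not> ?thesis"
  then have zero: "(\<Sum>i\<in>S. \<Sum>t<2 * e. of_bool (F (i, t) = a) :: bit) = 0" if "a \<in> V" for a
    using that by auto
  have "2 \<le> card {u \<in> U. F u = a}" if a: "a \<in> F ` U" for a
  proof -
    \<comment> \<open>In \<open>bit\<close> the double sum is the parity of the fibre of
      \<open>F\<close> over \<open>a\<close>.\<close>
    have "(\<Sum>i\<in>S. \<Sum>t<2 * e. of_bool (F (i, t) = a) :: bit) = (\<Sum>u\<in>U. of_bool (F u = a))"
      by (simp only: U_def sum.cartesian_product case_prod_unfold prod.collapse)
    also have "\<dots> = of_nat (card {u \<in> U. F u = a})"
      using finU by (simp add: sum.If_cases of_bool_def Int_def)
    finally have "(of_nat (card {u \<in> U. F u = a}) :: bit) = 0"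
      using zero[of a] a assms(2) by (auto simp: U_def)
    then have "even (of_nat (card {u \<in> U. F u = a}) :: bit)" by simp
    then have "even (card {u \<in> U. F u = a})" by (simp only: even_of_nat_iff)
    moreover have "card {u \<in> U. F u = a} > 0"
      using a finU by (auto simp: card_gt_0_iff)
    ultimately show ?thesis by (metis dvd_imp_le)
  qed
  then have "card (F ` U) * 2 \<le> (\<Sum>a\<in>F ` U. card {u \<in> U. F u = a})"
    using sum_bounded_below[of "F ` U" 2 "\<lambda>a. card {u \<in> U. F u = a}"] by simp
  also have "\<dots> = card U"
    using sum.image_gen[OF finU, of "\<lambda>_. 1 :: nat" F] by simp
  also have "\<dots> = 2 * (e * card S)" by (simp add: U_def card_cartesian_product)
  finally show False using exp by (simp add: U_def)
qed

lemma submatrix_mult: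
  assumes "dim_col A = dim_row B"
  shows "submatrix (A * B) I J = submatrix A I UNIV * submatrix B UNIV J"
proof (rule eq_matI)
  fix i j
  assume "i < dim_row (submatrix A I UNIV * submatrix B UNIV J)"
    "j < dim_col (submatrix A I UNIV * submatrix B UNIV J)"
  then have ij: "i < card {i. i < dim_row A \<and> i \<in> I}" "j < card {j. j < dim_col B \<and> j \<in> J}"
    by (simp_all add: dim_submatrix)
  then show "submatrix (A * B) I J $$ (i, j) = (submatrix A I UNIV * submatrix B UNIV J) $$ (i, j)"
    using pick_le[OF ij(1)] pick_le[OF ij(2)] assms
    by (simp add: submatrix_def scalar_prod_def pick_UNIV)
qed (simp_all add: dim_submatrix)

lemma submatrix_UNIV_UNIV: "submatrix A UNIV UNIV = A"
  by (rule eq_matI) (simp_all add: submatrix_def pick_UNIV)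

lemma submatrix_transpose: "submatrix A\<^sup>T I J = (submatrix A J I)\<^sup>T"
  by (rule eq_matI) (auto simp: submatrix_def pick_le)

text \<open>Over the two-element field a linear combination is a sum over a subset, so
  \<open>indep\<close> is linear independence of the rows in \<open>I\<close>, and a dual family
  supplies the columns of the inverse.\<close>

lemma submatrix_right_inverse:
  fixes M :: "bit mat"
  assumes M: "M \<in> carrier_mat n m" and I: "I \<subseteq> {..<n}" "card I = k"
    and indep: "\<And>S. S \<subseteq> I \<Longrightarrow> S \<noteq> {} \<Longrightarrow> \<exists>a<m. (\<Sum>i\<in>S. M $$ (i, a)) \<noteq> 0"
  obtains L' where "L' \<in> carrier_mat m k" "submatrix M I UNIV * L' = 1\<^sub>m k"
    "submatrix M I UNIV \<in> carrier_mat k m"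
proof -
  have fI: "{i. i < n \<and> i \<in> I} = I" using I by auto
  \<comment> \<open>\<open>pick I\<close> enumerates \<open>I\<close> increasingly, so it is
    inverted by counting the elements of \<open>I\<close> below a given one.\<close>
  have inj: "inj_on (pick I) {..<k}"
    by (rule inj_on_inverseI[of _ "\<lambda>p. card {a \<in> I. a < p}"]) (use I card_pick_le in auto)
  have "\<forall>i\<in>{..<k}. c i = 0"
    if c: "\<And>a. a \<in> {..<m} \<Longrightarrow> (\<Sum>i\<in>{..<k}. c i * M $$ (pick I i, a)) = 0" for c
  proof (rule ccontr)
    define T where "T = {i. i < k \<and> c i \<noteq> 0}"
    assume "\<not> ?thesis"
    then have "T \<noteq> {}" by (auto simp: T_def)
    moreover have "pick I ` T \<subseteq> I" using I pick_in_set_le by (auto simp: T_def)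
    ultimately obtain a where a: "a < m" "(\<Sum>i\<in>pick I ` T. M $$ (i, a)) \<noteq> 0"
      using indep[of "pick I ` T"] by auto
    have "(\<Sum>i\<in>pick I ` T. M $$ (i, a)) = (\<Sum>i\<in>T. M $$ (pick I i, a))"
      using inj_on_subset[OF inj, of T] by (subst sum.reindex) (auto simp: T_def)
    also have "\<dots> = (\<Sum>i\<in>{..<k}. c i * M $$ (pick I i, a))"
      by (rule sum.mono_neutral_cong_left) (auto simp: T_def)
    finally show False using a c by simp
  qed
  then have "\<exists>W. \<forall>i\<in>{..<k}. \<forall>j\<in>{..<k}. (\<Sum>a<m. M $$ (pick I i, a) * W a j) = of_bool (i = j)"
    by (intro dual_family_exists) auto
  then obtain W where W: "\<And>i j. i < k \<Longrightarrow> j < k \<Longrightarrow> (\<Sum>a<m. M $$ (pick I i, a) * W a j) = of_bool (i = j)"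
    by blast
  show thesis
  proof
    show "mat m k (\<lambda>(a, j). W a j) \<in> carrier_mat m k" by simp
    show carr: "submatrix M I UNIV \<in> carrier_mat k m" using M fI I by (auto simp: submatrix_def)
    show "submatrix M I UNIV * mat m k (\<lambda>(a, j). W a j) = 1\<^sub>m k"
    proof (rule eq_matI)
      fix i j assume "i < dim_row (1\<^sub>m k :: bit mat)" "j < dim_col (1\<^sub>m k :: bit mat)"
      then show "(submatrix M I UNIV * mat m k (\<lambda>(a, j). W a j)) $$ (i, j) = 1\<^sub>m k $$ (i, j)"
        using M fI I W[of i j]
        by (auto simp: submatrix_def scalar_prod_def pick_UNIV atLeast0LessThan)
    qed (use carr in auto)
  qed
qed

lemma k_uniform_sandwich:
  fixes M :: "bit mat"
  assumes M: "M \<in> carrier_mat n m" and "k \<le> n"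
    and indep: "\<And>S. S \<subseteq> {..<n} \<Longrightarrow> S \<noteq> {} \<Longrightarrow> card S \<le> k \<Longrightarrow> \<exists>a<m. (\<Sum>i\<in>S. M $$ (i, a)) \<noteq> 0"
  shows "k_uniform n k (map_pmf (\<lambda>X. M * X * M\<^sup>T) (pmf_of_set (carrier_mat m m)))"
proof -
  let ?u = "pmf_of_set (carrier_mat m m) :: bit mat pmf"
  have "carrier_mat m m \<noteq> ({} :: bit mat set)" using zero_carrier_mat by blast
  then have set_u: "set_pmf ?u = carrier_mat m m"
    using finite_carrier_mat[OF finite_UNIV_bit] by simp
  have "map_pmf (\<lambda>A. submatrix A I J) (map_pmf (\<lambda>X. M * X * M\<^sup>T) ?u) = pmf_of_set (carrier_mat k k)"
    if IJ: "I \<subseteq> {..<n}" "J \<subseteq> {..<n}" "card I = k" "card J = k" for I J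
  proof -
    have ind: "\<exists>a<m. (\<Sum>i\<in>S. M $$ (i, a)) \<noteq> 0" if "S \<subseteq> K" "S \<noteq> {}" "K \<subseteq> {..<n}" "card K = k" for S K
    proof (rule indep)
      show "card S \<le> k" using that card_mono[of K S] finite_subset[of K "{..<n}"] by auto
    qed (use that in auto)
    obtain L' where L': "L' \<in> carrier_mat m k" "submatrix M I UNIV * L' = 1\<^sub>m k"
      "submatrix M I UNIV \<in> carrier_mat k m"
      using submatrix_right_inverse[OF M IJ(1,3)] ind IJ by metis
    obtain R' where R': "R' \<in> carrier_mat m k" "submatrix M J UNIV * R' = 1\<^sub>m k"
      "submatrix M J UNIV \<in> carrier_mat k m"
      using submatrix_right_inverse[OF M IJ(2,4)] ind IJ by metis
    \<comment> \<open>Transposition turns the right inverse of the rows in \<open>J\<close> into the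
      left inverse needed for the factor on the right.\<close>
    have RT: "R'\<^sup>T * (submatrix M J UNIV)\<^sup>T = 1\<^sub>m k"
      using transpose_mult[OF R'(3,1)] R'(2) by simp
    have "submatrix (M * X * M\<^sup>T) I J = submatrix M I UNIV * X * (submatrix M J UNIV)\<^sup>T"
      if "X \<in> carrier_mat m m" for X
      using that M R'(3) by (simp add: submatrix_mult submatrix_UNIV_UNIV submatrix_transpose
          assoc_mult_mat[OF L'(3) that, of _ k])
    then have "map_pmf (\<lambda>A. submatrix A I J) (map_pmf (\<lambda>X. M * X * M\<^sup>T) ?u) =
        map_pmf (\<lambda>X. submatrix M I UNIV * X * (submatrix M J UNIV)\<^sup>T) ?u"
      unfolding pmf.map_comp by (intro map_pmf_cong) (simp_all add: set_u)
    also have "\<dots> = pmf_of_set (carrier_mat k k)"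
      using L' R' RT by (intro map_pmf_mult_mat_uniform[OF finite_UNIV_bit]) auto
    finally show ?thesis .
  qed
  moreover have "set_pmf (map_pmf (\<lambda>X. M * X * M\<^sup>T) ?u) \<subseteq> carrier_mat n n"
    using M by (auto simp: set_u)
  ultimately show ?thesis using \<open>k \<le> n\<close> by (auto simp: k_uniform_def)
qed

text \<open>\<open>M\<close> is the incidence matrix modulo 2 of an expanding function. Parallel
  edges may cancel, which only shrinks the support below the \<open>2 * e * n\<close> edges.\<close>

lemma exists_sparse_k_independent:
  fixes n m k e :: nat
  assumes "2 * n * (e * k) ^ (2 * e) \<le> m ^ e" "m > 0"
  obtains M :: "bit mat" where "M \<in> carrier_mat n m" "card (support_mat M) \<le> 2 * e * n"
    "\<And>S. S \<subseteq> {..<n} \<Longrightarrow> S \<noteq> {} \<Longrightarrow> card S \<le> k \<Longrightarrow> \<exists>a<m. (\<Sum>i\<in>S. M $$ (i, a)) \<noteq> 0"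
proof -
  obtain F where F: "F \<in> {..<n} \<times> {..<2 * e} \<rightarrow>\<^sub>E {..<m}"
    and exp: "\<And>S. S \<subseteq> {..<n} \<Longrightarrow> S \<noteq> {} \<Longrightarrow> card S \<le> k \<Longrightarrow> e * card S < card (F ` (S \<times> {..<2 * e}))"
    using exists_expanding_function[OF assms] by metis
  define M where "M = mat n m (\<lambda>(i, a). \<Sum>t<2 * e. of_bool (F (i, t) = a) :: bit)"
  show thesis
  proof
    show "M \<in> carrier_mat n m" by (simp add: M_def)
    have "support_mat M \<subseteq> (\<lambda>(i, t). (i, F (i, t))) ` ({..<n} \<times> {..<2 * e})"
    proof clarify
      fix i a assume "(i, a) \<in> support_mat M"
      then have ia: "i < n" "(\<Sum>t<2 * e. of_bool (F (i, t) = a) :: bit) \<noteq> 0"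
        by (auto simp: support_mat_def M_def)
      from ia(2) obtain t where "t < 2 * e" "F (i, t) = a"
        by (rule sum.not_neutral_contains_not_neutral) auto
      then show "(i, a) \<in> (\<lambda>(i, t). (i, F (i, t))) ` ({..<n} \<times> {..<2 * e})"
        using ia by force
    qed
    then show "card (support_mat M) \<le> 2 * e * n"
      using surj_card_le[of "{..<n} \<times> {..<2 * e}"] by (simp add: card_cartesian_product mult.commute)
    fix S assume S: "S \<subseteq> {..<n}" "S \<noteq> {}" "card S \<le> k"
    have "F ` (S \<times> {..<2 * e}) \<subseteq> {..<m}" using F S by auto
    then obtain a where a: "a < m" "(\<Sum>i\<in>S. \<Sum>t<2 * e. of_bool (F (i, t) = a) :: bit) \<noteq> 0"
      using sum_incidence_nonzero[OF finite_subset[OF S(1) finite_lessThan] _ exp[OF S]] by blast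
    moreover have "(\<Sum>i\<in>S. M $$ (i, a)) = (\<Sum>i\<in>S. \<Sum>t<2 * e. of_bool (F (i, t) = a))"
      using S a(1) by (intro sum.cong) (auto simp: M_def)
    ultimately show "\<exists>a<m. (\<Sum>i\<in>S. M $$ (i, a)) \<noteq> 0" by metis
  qed
qed

section \<open>Choice of parameters\<close>

lemma exists_floor_root:
  fixes n r :: nat
  assumes "r > 0"
  obtains q where "q ^ r \<le> n" "n < (q + 1) ^ r"
proof -
  have "n < (n + 1) ^ r" using assms self_le_power[of "n + 1" r] by simp
  moreover have "\<not> n < 0 ^ r" using assms by (simp add: zero_power)
  ultimately obtain q where q: "\<forall>i\<le>q. \<not> n < i ^ r" "n < Suc q ^ r"
    using ex_least_nat_less[of "\<lambda>x. n < x ^ r" "n + 1"] by blast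
  show thesis
  proof (rule that)
    show "q ^ r \<le> n" using q(1) by (simp add: linorder_not_less)
    show "n < (q + 1) ^ r" using q(2) by simp
  qed
qed

theorem theorem3:
  "\<exists>c C :: real. c > 0 \<and> C > 0 \<and>
     (\<forall>\<^sub>F n :: nat in sequentially.
        \<exists>p :: bit mat pmf.
          set_pmf p \<subseteq> carrier_mat n n \<and>
          (\<exists>k :: nat. real k \<ge> real n powr c \<and> k_uniform n k p) \<and>
          (\<forall>A \<in> set_pmf p. ereal_of_enat (C_xor A) \<le> ereal (C * real n)))"
proof (rule exI[of _ "1 / 32"], rule exI[of _ 37], intro conjI)
  show "\<forall>\<^sub>F n :: nat in sequentially.
        \<exists>p :: bit mat pmf.
          set_pmf p \<subseteq> carrier_mat n n \<and>
          (\<exists>k :: nat. real k \<ge> real n powr (1 / 32) \<and> k_uniform n k p) \<and>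
          (\<forall>A \<in> set_pmf p. ereal_of_enat (C_xor A) \<le> ereal (37 * real n))"
  \<comment> \<open>The threshold forces \<open>q\<close> to be at least 8, so that a power of
    \<open>q\<close> can absorb the constants below.\<close>
  proof (rule eventually_sequentiallyI[of "8 ^ 16"])
    fix n :: nat assume n: "8 ^ 16 \<le> n"
    obtain q where q: "q ^ 16 \<le> n" "n < (q + 1) ^ 16"
      using exists_floor_root[of 16 n] by auto
    have "8 < q + 1"
    proof (rule ccontr)
      assume "\<not> ?thesis"
      then have "(q + 1) ^ 16 \<le> 8 ^ 16" by (intro power_mono) auto
      then show False using n q(2) by (meson leD order_trans)
    qed
    then have q8: "8 \<le> q" by simp
    define m where "m = q ^ 8"
    have mm: "m * m \<le> n" using q(1) by (simp add: m_def flip: power_add)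
    have m0: "m > 0" using q8 by (simp add: m_def)
    then have "m \<le> m * m" by simp
    then have mn: "m \<le> n" using mm by linarith
    have "n \<le> (2 * q) ^ 16"
    proof -
      have "(q + 1) ^ 16 \<le> (2 * q) ^ 16" using q8 by (intro power_mono) auto
      then show ?thesis using q(2) by (meson less_imp_le order_trans)
    qed
    \<comment> \<open>This is the expansion condition for \<open>e = 8\<close>. Its left side has
      order \<open>q ^ 32\<close> and its right side is \<open>m ^ 8 = q ^ 64\<close>; the constant
      \<open>2 ^ 65\<close> is covered by \<open>8 ^ 32\<close>, at most
      \<open>q ^ 32\<close>.\<close>
    then have "2 * n * (8 * q) ^ (2 * 8) \<le> 2 * (2 * q) ^ 16 * (8 * q) ^ (2 * 8)"
      by (intro mult_le_mono) auto
    also have "\<dots> = 2 ^ 65 * q ^ 32" by (simp add: power_mult_distrib)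
    also have "\<dots> \<le> 8 ^ 32 * q ^ 32" by (intro mult_le_mono) auto
    also have "\<dots> \<le> q ^ 32 * q ^ 32" by (intro mult_le_mono power_mono q8) auto
    also have "\<dots> = m ^ 8" by (simp add: m_def flip: power_add power_mult)
    finally obtain M :: "bit mat" where M: "M \<in> carrier_mat n m" "card (support_mat M) \<le> 2 * 8 * n"
      and indep: "\<And>S. S \<subseteq> {..<n} \<Longrightarrow> S \<noteq> {} \<Longrightarrow> card S \<le> q \<Longrightarrow> \<exists>a<m. (\<Sum>i\<in>S. M $$ (i, a)) \<noteq> 0"
      using exists_sparse_k_independent[of n 8 q m] m0 by metis
    define p where "p = map_pmf (\<lambda>X. M * X * M\<^sup>T) (pmf_of_set (carrier_mat m m))"
    have "q \<le> n" using q(1) self_le_power[of q 16] q8 by linarith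
    then have unif: "k_uniform n q p"
      unfolding p_def by (rule k_uniform_sandwich[OF M(1) _ indep])
    have "real n powr (1 / 32) \<le> real q"
    proof -
      \<comment> \<open>The exponent 1/32 instead of 1/16 pays for rounding: the crude bound of
        \<open>q + 1\<close> by \<open>q * q\<close> suffices.\<close>
      have "(q + 1) ^ 16 \<le> (q * q) ^ 16"
      proof (rule power_mono)
        have "q + 1 \<le> 8 * q" using q8 by simp
        also have "\<dots> \<le> q * q" using q8 by (rule mult_le_mono1)
        finally show "q + 1 \<le> q * q" .
      qed simp
      also have "\<dots> = q ^ 32" by (simp add: power_mult_distrib flip: power_add)
      finally have "n \<le> q ^ 32" using q(2) by (meson less_imp_le order_trans)
      then have "real n \<le> real q ^ 32" by (metis of_nat_le_iff of_nat_power)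
      then have "real n powr (1 / 32) \<le> (real q ^ 32) powr (1 / 32)" by (intro powr_mono2) auto
      also have "real q ^ 32 = real q powr 32" by simp
      also have "(real q powr 32) powr (1 / 32) = real q" using q8 unfolding powr_powr by simp
      finally show ?thesis .
    qed
    moreover have "ereal_of_enat (C_xor A) \<le> ereal (37 * real n)" if A: "A \<in> set_pmf p" for A
    proof -
      have "carrier_mat m m \<noteq> ({} :: bit mat set)" using zero_carrier_mat by blast
      then obtain X where X: "X \<in> carrier_mat m m" "A = M * X * M\<^sup>T"
        using A finite_carrier_mat[OF finite_UNIV_bit] by (auto simp: p_def)
      have "card (support_mat X) \<le> m * m" using card_support_mat_le[of X] X by simp
      \<comment> \<open>The constant 37 is 16 + 16 for \<open>M\<close> and its transpose, and 1
        each for \<open>m * m\<close>, the two summands \<open>m\<close>, the summand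
        \<open>n\<close> and the 3.\<close>
      then have "card (support_mat M) + card (support_mat X) + card (support_mat M\<^sup>T) + (m + m + n + 3)
          \<le> 37 * n"
        using M(2) mm mn n by simp
      moreover have "C_xor A \<le> enat (card (support_mat M) + card (support_mat X) + card (support_mat M\<^sup>T) + (m + m + n + 3))"
        unfolding X(2) using n M(1) by (intro C_xor_mult3_le[OF M(1) X(1)]) auto
      ultimately have "C_xor A \<le> enat (37 * n)" by (meson enat_ord_simps(1) order_trans)
      then have "ereal_of_enat (C_xor A) \<le> ereal_of_enat (enat (37 * n))"
        by (simp only: ereal_of_enat_le_iff)
      then show ?thesis by simp
    qed
    ultimately show "\<exists>p :: bit mat pmf.
          set_pmf p \<subseteq> carrier_mat n n \<and>
          (\<exists>k :: nat. real k \<ge> real n powr (1 / 32) \<and> k_uniform n k p) \<and>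
          (\<forall>A \<in> set_pmf p. ereal_of_enat (C_xor A) \<le> ereal (37 * real n))"
      using unif by (auto simp: k_uniform_def)
  qed
qed simp_all

end
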